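(* For cost utilities, BOS satisfies EJR up to $\frac{n-|S|}{2|S|}\cdot c^*$, where $c^*:=\max_{c\in C}\mathrm{cost}(c)$. That is, let $(C,V,b)$ be a participatory budgeting election with approval ballots $A_i\subseteq C$ and cost utilities, let $n=|V|$, and let $W$ be an outcome returned by BOS. Then for every nonempty $S\subseteq V$ and every $T\subseteq C$ such that $S$ deserves the satisfaction of $\mathrm{cost}(T)$, there is a voter $v_i\in S$ such that for all $c\in T\setminus W$, $$u_i(W)\;\ge\;\mathrm{cost}(T)-\frac{n-|S|}{2|S|}\cdot c^*-\mathrm{cost}(c).$$
   Context: Election. A participatory budgeting election is a tuple $(C,V,b)$ with a finite set of candidates $C$, a finite nonempty set of voters $V=\{v_1,\dots,v_n\}$ and a budget $b>0$. Each $c\in C$ has a cost $\mathrm{cost}(c)\in(0,b]$, with $\mathrm{cost}(W)=\sum_{c\in W}\mathrm{cost}(c)$ for $W\subseteq C$. Each voter $v_i$ has an approval set $A_i\subseteq C$. Cost utilities: $u_i(c)=\mathrm{cost}(c)$ if $c\in A_i$ and $u_i(c)=0$ otherwise; $u_i(W)=\sum_{c\in W}u_i(c)=\mathrm{cost}(W\cap A_i)$. Deserving. A group $S\subseteq V$ deserves the satisfaction of $\mathrm{cost}(T)$, for $T\subseteq C$, if $|S|\ge\mathrm{cost}(T)\cdot\frac{n}{b}$ and $T\subseteq\bigcap_{v_i\in S}A_i$. Affordability. Given current voter budgets $b_i\ge 0$, a candidate $c$ is $(\alpha,\rho)$-affordable, for $\alpha\in(0,1]$ and $\rho\in\mathbb{R}_+$,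 if $\alpha\cdot\mathrm{cost}(c)=\sum_{v_i\in V}\min(b_i,\ \alpha\cdot u_i(c)\cdot\rho)$. BOS (Method of Equal Shares with Bounded Overspending). Initially $W=\emptyset$ and $b_i=b/n$ for each voter $v_i$. In each round, consider all candidates $c\in C\setminus W$ with $\mathrm{cost}(c)\le b-\mathrm{cost}(W)$, and all pairs $(\alpha,\rho)$, $\alpha\in(0,1]$, $\rho\in\mathbb{R}_+$, for which such a $c$ is $(\alpha,\rho)$-affordable. If there is none, stop and return $W$. Otherwise choose a triple $(c,\alpha,\rho)$ with the lowest value of $\rho/\alpha$ (ties broken arbitrarily), add $c$ to $W$, set $b_i:=\max(0,\ b_i-u_i(c)\cdot\rho)$ for every voter $v_i$, and go to the next round. *)

theory Defs
  imports Complex_Main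
begin

record ('c, 'v) pb_instance =
  cands :: "'c set"
  voters :: "'v set"
  budget :: real
  cost :: "'c \<Rightarrow> real"
  approves :: "'v \<Rightarrow> 'c set"

definition election :: "('c, 'v) pb_instance \<Rightarrow> bool" where
  "election E \<longleftrightarrow>
     finite (cands E) \<and> finite (voters E) \<and> voters E \<noteq> {} \<and> budget E > 0 \<and>
     (\<forall>c \<in> cands E. 0 < cost E c \<and> cost E c \<le> budget E) \<and>
     (\<forall>i \<in> voters E. approves E i \<subseteq> cands E)"

definition num_voters :: "('c, 'v) pb_instance \<Rightarrow> real" where
  "num_voters E = real (card (voters E))"

definition total_cost :: "('c, 'v) pb_instance \<Rightarrow> 'c set \<Rightarrow> real" where
  "total_cost E W = (\<Sum>c\<in>W. cost E c)"

definition utility :: "('c, 'v) pb_instance \<Rightarrow> 'v \<Rightarrow> 'c \<Rightarrow> real" where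
  "utility E i c = (if c \<in> approves E i then cost E c else 0)"

definition set_utility :: "('c, 'v) pb_instance \<Rightarrow> 'v \<Rightarrow> 'c set \<Rightarrow> real" where
  "set_utility E i W = (\<Sum>c\<in>W. utility E i c)"

definition deserves :: "('c, 'v) pb_instance \<Rightarrow> 'v set \<Rightarrow> 'c set \<Rightarrow> bool" where
  "deserves E S T \<longleftrightarrow>
     real (card S) \<ge> total_cost E T * (num_voters E / budget E) \<and>
     T \<subseteq> (\<Inter>i\<in>S. approves E i)"

text \<open>In the following, \<open>bd i\<close> is the current budget of voter \<open>i\<close>.
  Since costs are positive, \<open>\<rho> = 0\<close> never satisfies the equation, so it does not matter
  whether \<open>\<rho>\<close> ranges over the nonnegative or the positive reals.\<close>

definition affordable ::
    "('c, 'v) pb_instance \<Rightarrow> ('v \<Rightarrow> real) \<Rightarrow> 'c \<Rightarrow> real \<Rightarrow> real \<Rightarrow> bool" where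
  "affordable E bd c \<alpha> \<rho> \<longleftrightarrow>
     0 < \<alpha> \<and> \<alpha> \<le> 1 \<and> 0 \<le> \<rho> \<and>
     \<alpha> * cost E c = (\<Sum>i\<in>voters E. min (bd i) (\<alpha> * utility E i c * \<rho>))"

definition bos_choices ::
    "('c, 'v) pb_instance \<Rightarrow> 'c set \<Rightarrow> ('v \<Rightarrow> real) \<Rightarrow> ('c \<times> real \<times> real) set" where
  "bos_choices E W bd =
     {(c, \<alpha>, \<rho>). c \<in> cands E - W \<and> cost E c \<le> budget E - total_cost E W \<and>
                affordable E bd c \<alpha> \<rho>}"

text \<open>\<open>bos_state E W bd\<close>: some run of the rule, under some tie-breaking, reaches the selected
  set \<open>W\<close> with voter budgets \<open>bd\<close> at the beginning of a round.\<close>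

inductive bos_state :: "('c, 'v) pb_instance \<Rightarrow> 'c set \<Rightarrow> ('v \<Rightarrow> real) \<Rightarrow> bool"
  for E :: "('c, 'v) pb_instance" where
  init: "bos_state E {} (\<lambda>i. budget E / num_voters E)"
| step: "\<lbrakk> bos_state E W bd; (c, \<alpha>, \<rho>) \<in> bos_choices E W bd;
           \<forall>(c', \<alpha>', \<rho>') \<in> bos_choices E W bd. \<rho> / \<alpha> \<le> \<rho>' / \<alpha>' \<rbrakk>
         \<Longrightarrow> bos_state E (insert c W) (\<lambda>i. max 0 (bd i - utility E i c * \<rho>))"

definition bos_outcome :: "('c, 'v) pb_instance \<Rightarrow> 'c set \<Rightarrow> bool" where
  "bos_outcome E W \<longleftrightarrow> (\<exists>bd. bos_state E W bd \<and> bos_choices E W bd = {})"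

text \<open>Unspecified if there are no candidates.\<close>

definition max_cost :: "('c, 'v) pb_instance \<Rightarrow> real" where
  "max_cost E = Max (cost E ` cands E)"

end

theory Submission
  imports Defs
begin

text \<open>
  Fix the cheapest \<open>c \<in> T - W\<close> and write \<open>s = |S|\<close>. As long as \<open>c\<close> fits into the remaining budget
  and every voter of \<open>S\<close> still has at least \<open>cost c / s\<close>, the candidate \<open>c\<close> is
  \<open>(1, \<rho>)\<close>-affordable with \<open>\<rho> \<le> 1/s\<close>, so every purchase satisfies \<open>\<rho>/\<alpha> \<le> 1/s\<close>. If a voter of
  \<open>S\<close> drops below \<open>cost c / s\<close>, it has paid at most \<open>1/s\<close> per unit of utility, which gives the
  bound without the overspending term. Otherwise \<open>c\<close> stops fitting, and the overspending has to be
  bounded. If \<open>\<alpha> < 1\<close> in a purchase, then, since increasing \<open>\<alpha>\<close> does not lower \<open>\<rho>/\<alpha>\<close>, the voters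
  exhausted by the purchase cover at least half of the \<open>\<alpha>\<close>-fraction of the cost. If there are \<open>k\<close>
  of them, then \<open>1 \<le> 2k\<rho> \<le> 2k\<alpha>/s\<close>, hence \<open>1 - \<alpha> \<le> 1/(4\<alpha>) \<le> k/(2s)\<close>. As each of the \<open>n - s\<close>
  voters outside \<open>S\<close> is exhausted at most once, the total overspending that counts is at most
  \<open>(n - s)/(2s)\<close> times the maximal cost.
\<close>

section \<open>Affordability in terms of a common payment cap\<close>

definition supporters :: "('c, 'v) pb_instance \<Rightarrow> 'c \<Rightarrow> 'v set" where
  "supporters E c = {i \<in> voters E. c \<in> approves E i}"

lemma finite_supporters: "election E \<Longrightarrow> finite (supporters E c)"
  by (simp add: supporters_def election_def)

text \<open>A non-supporter contributes \<open>min (bd i) 0\<close>, which vanishes because budgets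
  are nonnegative.\<close>

lemma affordable_iff_supporters:
  assumes "election E" and "\<And>i. i \<in> voters E \<Longrightarrow> 0 \<le> bd i"
  shows "affordable E bd c \<alpha> \<rho> \<longleftrightarrow> 0 < \<alpha> \<and> \<alpha> \<le> 1 \<and> 0 \<le> \<rho> \<and>
           \<alpha> * cost E c = (\<Sum>i\<in>supporters E c. min (bd i) (\<alpha> * \<rho> * cost E c))"
proof -
  have "finite (voters E)" using assms(1) by (simp add: election_def)
  then have "(\<Sum>i\<in>voters E. min (bd i) (\<alpha> * utility E i c * \<rho>)) =
        (\<Sum>i\<in>supporters E c. min (bd i) (\<alpha> * \<rho> * cost E c))"
    unfolding supporters_def
    by (intro sum.mono_neutral_cong_right) (auto simp: utility_def assms(2) mult.commute mult.left_commute)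
  then show ?thesis by (simp add: affordable_def)
qed

text \<open>Here \<open>x\<close> is the per-voter cap; solving
  \<open>x = \<alpha> * \<rho> * cost E c\<close> for \<rho> gives the stated value.\<close>

lemma affordable_if_share:
  assumes E: "election E" and nn: "\<And>i. i \<in> voters E \<Longrightarrow> 0 \<le> bd i"
    and c: "c \<in> cands E" and "0 \<le> x" "0 < \<alpha>" "\<alpha> \<le> 1"
    and "(\<Sum>i\<in>supporters E c. min (bd i) x) = \<alpha> * cost E c"
  shows "affordable E bd c \<alpha> (x / (\<alpha> * cost E c))"
proof -
  have "0 < cost E c" using E c by (simp add: election_def)
  then have "\<alpha> * (x / (\<alpha> * cost E c)) * cost E c = x" "0 \<le> x / (\<alpha> * cost E c)"
    using assms by auto
  then show ?thesis using assms by (simp add: affordable_iff_supporters)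
qed

text \<open>As the cap grows from 0 to \<open>cost E c / card S\<close>, the collected sum grows
  continuously from 0 to at least \<open>cost E c\<close>, since \<open>S\<close> alone pays that
  much at the upper end. The intermediate value theorem yields a cap that collects exactly the
  cost.\<close>

lemma affordable_of_rich_group:
  assumes E: "election E" and nn: "\<And>i. i \<in> voters E \<Longrightarrow> 0 \<le> bd i"
    and c: "c \<in> cands E" and S: "S \<subseteq> supporters E c" "S \<noteq> {}"
    and rich: "\<And>i. i \<in> S \<Longrightarrow> cost E c / real (card S) \<le> bd i"
  shows "\<exists>\<rho>. affordable E bd c 1 \<rho> \<and> \<rho> \<le> 1 / real (card S)"
proof -
  let ?f = "\<lambda>x. \<Sum>i\<in>supporters E c. min (bd i) x"
  have fin: "finite (supporters E c)" by (rule finite_supporters[OF E])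
  then have s: "0 < real (card S)" using S by (meson card_gt_0_iff finite_subset of_nat_0_less_iff)
  have pos: "0 < cost E c" using E c by (simp add: election_def)
  have nn': "0 \<le> bd i" if "i \<in> supporters E c" for i
    using that nn by (simp add: supporters_def)
  have "cost E c = (\<Sum>i\<in>S. min (bd i) (cost E c / real (card S)))"
    using rich s by (simp add: min_absorb2)
  also have "\<dots> \<le> ?f (cost E c / real (card S))"
    using fin S pos nn' by (intro sum_mono2) auto
  finally have "cost E c \<le> ?f (cost E c / real (card S))" .
  moreover have "?f 0 \<le> cost E c"
    using nn' pos by (simp add: min_absorb2)
  moreover have "continuous_on {0 .. cost E c / real (card S)} ?f"
    by (intro continuous_intros)
  ultimately obtain x where x: "0 \<le> x" "x \<le> cost E c / real (card S)" "?f x = cost E c"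
    using IVT'[of ?f 0 "cost E c" "cost E c / real (card S)"] pos s by auto
  have "affordable E bd c 1 (x / (1 * cost E c))"
    using x by (intro affordable_if_share[OF E nn c]) auto
  moreover have "x / (1 * cost E c) \<le> 1 / real (card S)"
    using x(2) pos s by (simp add: field_simps)
  ultimately show ?thesis by blast
qed

section \<open>Overspending in a single purchase\<close>

text \<open>With \<open>x\<close> the per-voter payment, \<open>\<rho>/\<alpha> = x cost / f(x)\<^sup>2\<close> for the concave piecewise linear
  \<open>f(x) = \<Sum>\<^sub>i min b\<^sub>i x\<close>; the claim says that the
  right derivative of this quotient is nonnegative.\<close>

lemma exhausted_pay_half:
  assumes E: "election E" and nn: "\<And>i. i \<in> voters E \<Longrightarrow> 0 \<le> bd i"
    and c: "c \<in> cands E" and aff: "affordable E bd c \<alpha> \<rho>" and "\<alpha> < 1"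
    and opt: "\<And>\<alpha>' \<rho>'. affordable E bd c \<alpha>' \<rho>' \<Longrightarrow> \<rho> / \<alpha> \<le> \<rho>' / \<alpha>'"
  shows "\<alpha> * cost E c \<le> 2 * (\<Sum>i\<in>{i\<in>supporters E c. bd i \<le> \<alpha> * \<rho> * cost E c}. bd i)"
proof (rule ccontr)
  define x where "x = \<alpha> * \<rho> * cost E c"
  define P where "P = {i\<in>supporters E c. bd i \<le> x}"
  define R where "R = {i\<in>supporters E c. x < bd i}"
  define f where "f = \<alpha> * cost E c"
  let ?m = "real (card R)"
  assume "\<not> ?thesis"
  then have less: "2 * sum bd P < f" by (simp add: P_def x_def f_def)
  have fin: "finite P" "finite R" using finite_supporters[OF E] by (auto simp: P_def R_def)
  have un: "supporters E c = P \<union> R" "P \<inter> R = {}" by (auto simp: P_def R_def)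
  have share: "(\<Sum>i\<in>supporters E c. min (bd i) y) = sum bd P + ?m * y"
    if "x \<le> y" "\<And>i. i \<in> R \<Longrightarrow> y \<le> bd i" for y
  proof -
    have "(\<Sum>i\<in>P. min (bd i) y) = sum bd P"
      using that(1) by (intro sum.cong) (auto simp: P_def)
    moreover have "(\<Sum>i\<in>R. min (bd i) y) = (\<Sum>i\<in>R. y)"
      using that(2) by (intro sum.cong) auto
    ultimately show ?thesis using fin un by (simp add: sum.union_disjoint)
  qed
  have pos: "0 < cost E c" using E c by (simp add: election_def)
  have aff': "0 < \<alpha>" "0 \<le> \<rho>" "f = (\<Sum>i\<in>supporters E c. min (bd i) x)"
    using aff affordable_iff_supporters[OF E nn] by (auto simp: x_def f_def)
  have f: "f = sum bd P + ?m * x"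
    using aff'(3) share[of x] by (auto simp: R_def)
  have "0 \<le> sum bd P" using nn by (intro sum_nonneg) (auto simp: P_def supporters_def)
  then have mx: "f < 2 * (?m * x)" "0 < ?m * x" using less f by linarith+
  have fpos: "0 < f" "f < cost E c" using pos aff'(1) \<open>\<alpha> < 1\<close> by (auto simp: f_def)
  have "0 \<le> x" using aff' pos by (simp add: x_def)
  with mx have x: "0 < x" and m: "0 < ?m" by (auto simp: zero_less_mult_iff)
  \<comment> \<open>A larger cap. Staying below every budget in \<open>R\<close> keeps the collected
    sum linear with slope \<open>?m\<close>; the other bound keeps the new fraction
    \<open>g / cost E c\<close> at most 1.\<close>
  define y where "y = Min (insert (x + (cost E c - f) / ?m) (bd ` R))"
  have y: "x < y" "y \<le> x + (cost E c - f) / ?m" "\<And>i. i \<in> R \<Longrightarrow> y \<le> bd i"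
    using fin m fpos by (auto simp: y_def R_def)
  define g where "g = f + ?m * (y - x)"
  have fy: "(\<Sum>i\<in>supporters E c. min (bd i) y) = g"
    using share[OF less_imp_le[OF y(1)] y(3)] f by (simp add: g_def algebra_simps)
  have g: "0 < g" "g \<le> cost E c"
  proof -
    show "0 < g" using fpos m y(1) by (simp add: g_def add_pos_pos)
    have "?m * (y - x) \<le> ?m * ((cost E c - f) / ?m)"
      using y(2) m by (intro mult_left_mono) auto
    then show "g \<le> cost E c" using m by (simp add: g_def)
  qed
  have "affordable E bd c (g / cost E c) (y / (g / cost E c * cost E c))"
    using g pos x y fy by (intro affordable_if_share[OF E nn c]) auto
  from opt[OF this] have "\<rho> / \<alpha> \<le> y * cost E c / (g * g)"
    using pos by (simp add: field_simps)
  moreover have "\<rho> / \<alpha> = x * cost E c / (f * f)"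
    using pos aff'(1) by (simp add: x_def f_def field_simps)
  ultimately have "x * cost E c * (g * g) \<le> y * cost E c * (f * f)"
    using g(1) fpos(1) by (simp add: field_simps)
  then have le: "x * (g * g) \<le> y * (f * f)" using pos by (simp add: mult_ac)
  define e where "e = y - x"
  have e: "0 < e" using y(1) by (simp add: e_def)
  \<comment> \<open>To first order in \<open>e\<close>, the left side of \<open>le\<close> gains
    \<open>2 * f * e * (?m * x)\<close> and the right side only \<open>f * e * f\<close>, which is
    smaller by \<open>mx\<close>.\<close>
  have "x * (g * g) = x * f * f + 2 * f * e * (?m * x) + x * (?m * e) * (?m * e)"
    by (simp add: g_def e_def[symmetric] algebra_simps)
  moreover have "y * (f * f) = x * f * f + f * e * f"
    by (simp add: e_def algebra_simps)
  moreover have "f * e * f < f * e * (2 * (?m * x))"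
    using mx(1) fpos e by (intro mult_strict_left_mono) auto
  moreover have "0 \<le> x * (?m * e) * (?m * e)" using x e by (intro mult_nonneg_nonneg) auto
  ultimately show False using le by (simp add: mult_ac)
qed

text \<open>The rule charges the full \<open>\<rho> * cost E c\<close>, so the counted voters are
  those whose budget goes from positive to zero. This is what allows each voter to be counted only
  once over a run.\<close>

lemma one_minus_le_exhausted:
  assumes E: "election E" and nn: "\<And>i. i \<in> voters E \<Longrightarrow> 0 \<le> bd i"
    and c: "c \<in> cands E" and aff: "affordable E bd c \<alpha> \<rho>"
    and opt: "\<And>\<alpha>' \<rho>'. affordable E bd c \<alpha>' \<rho>' \<Longrightarrow> \<rho> / \<alpha> \<le> \<rho>' / \<alpha>'"
    and s: "0 < s" "\<rho> / \<alpha> \<le> 1 / s"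
  shows "1 - \<alpha> \<le> real (card {i\<in>supporters E c. 0 < bd i \<and> bd i \<le> \<rho> * cost E c}) / (2 * s)"
    (is "_ \<le> real (card ?K) / _")
proof (cases "\<alpha> < 1")
  case False
  then have "1 - \<alpha> \<le> 0" by simp
  also have "0 \<le> real (card ?K) / (2 * s)" using s by simp
  finally show ?thesis .
next
  case True
  let ?x = "\<alpha> * \<rho> * cost E c"
  let ?k = "real (card ?K)"
  have pos: "0 < cost E c" using E c by (simp add: election_def)
  have a: "0 < \<alpha>" "0 \<le> \<rho>" using aff by (auto simp: affordable_def)
  have fin: "finite (supporters E c)" by (rule finite_supporters[OF E])
  have x: "0 \<le> ?x" "?x \<le> \<rho> * cost E c"
    using a pos True by (auto intro!: mult_right_mono mult_left_le_one_le)
  have "(\<Sum>i\<in>{i\<in>supporters E c. bd i \<le> ?x}. bd i) =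
        (\<Sum>i\<in>{i\<in>supporters E c. 0 < bd i \<and> bd i \<le> ?x}. bd i)"
  proof (intro sum.mono_neutral_right ballI)
    fix i assume "i \<in> {i\<in>supporters E c. bd i \<le> ?x} - {i\<in>supporters E c. 0 < bd i \<and> bd i \<le> ?x}"
    then show "bd i = 0" using nn[of i] by (auto simp: supporters_def)
  qed (use fin in auto)
  also have "\<dots> \<le> real (card {i\<in>supporters E c. 0 < bd i \<and> bd i \<le> ?x}) * ?x"
    by (rule sum_bounded_above) auto
  \<comment> \<open>A voter exhausted at the cap scaled by \<alpha> is also exhausted by the full
    charge.\<close>
  also have "\<dots> \<le> ?k * ?x"
    using x fin by (intro mult_right_mono of_nat_mono card_mono) auto
  finally have "\<alpha> * cost E c \<le> 2 * (?k * ?x)"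
    using exhausted_pay_half[OF E nn c aff True opt] by simp
  then have "(\<alpha> * cost E c) * 1 \<le> (\<alpha> * cost E c) * (2 * ?k * \<rho>)" by (simp add: mult_ac)
  then have "1 \<le> 2 * ?k * \<rho>" using a pos mult_le_cancel_left_pos by fastforce
  also have "\<rho> \<le> \<alpha> / s" using s a by (simp add: field_simps)
  then have "2 * ?k * \<rho> \<le> 2 * ?k * (\<alpha> / s)" by (intro mult_left_mono) auto
  finally have "s \<le> 2 * ?k * \<alpha>" using s by (simp add: field_simps)
  have "0 \<le> (2 * \<alpha> - 1)\<^sup>2" by simp
  then have "4 * \<alpha> * (1 - \<alpha>) \<le> 1" by (simp add: power2_eq_square algebra_simps)
  then have "s * (4 * \<alpha> * (1 - \<alpha>)) \<le> s" using s by (simp add: mult_left_le)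
  with \<open>s \<le> 2 * ?k * \<alpha>\<close> have "(2 * \<alpha>) * (2 * s * (1 - \<alpha>)) \<le> (2 * \<alpha>) * ?k"
    by (simp add: algebra_simps)
  then have "2 * s * (1 - \<alpha>) \<le> ?k" using a by (subst (asm) mult_le_cancel_left_pos) auto
  then show ?thesis using s by (simp add: field_simps)
qed

section \<open>Accounting for one purchase\<close>

lemma bos_state_basic:
  assumes "election E" and "bos_state E W bd"
  shows "W \<subseteq> cands E \<and> finite W \<and> (\<forall>i. 0 \<le> bd i)"
  using assms(2,1)
  by (induction) (auto simp: election_def num_voters_def bos_choices_def)

text \<open>The per-purchase increment of the second conjunct of \<open>group_solvent\<close> below.\<close>

lemma purchase_outside_payment:
  assumes E: "election E" and nn: "\<And>i. i \<in> voters E \<Longrightarrow> 0 \<le> bd i"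
    and S: "S \<subseteq> voters E" "S \<noteq> {}"
    and d: "d \<in> cands E" and aff: "affordable E bd d \<alpha> \<rho>"
    and opt: "\<And>\<alpha>' \<rho>'. affordable E bd d \<alpha>' \<rho>' \<Longrightarrow> \<rho> / \<alpha> \<le> \<rho>' / \<alpha>'"
    and r: "\<rho> / \<alpha> \<le> 1 / real (card S)"
    and rich: "\<And>i. i \<in> S \<Longrightarrow> utility E i d * \<rho> < bd i"
  defines "bd' \<equiv> \<lambda>i. max 0 (bd i - utility E i d * \<rho>)"
  shows "cost E d - (\<Sum>i\<in>S. utility E i d) / real (card S)
    \<le> (\<Sum>i\<in>voters E - S. bd i - bd' i) + max_cost E / (2 * real (card S)) *
        (real (card {i\<in>voters E - S. bd' i = 0}) - real (card {i\<in>voters E - S. bd i = 0}))"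
proof -
  let ?s = "real (card S)"
  define K where "K = {i\<in>supporters E d. 0 < bd i \<and> bd i \<le> \<rho> * cost E d}"
  define U where "U = (\<Sum>i\<in>S. utility E i d)"
  have finV: "finite (voters E)" using E by (simp add: election_def)
  then have finS: "finite S" using S finite_subset by blast
  then have s: "0 < ?s" using S by (simp add: card_gt_0_iff)
  have pos: "0 < cost E d" using E d by (simp add: election_def)
  have a: "0 < \<alpha>" "\<alpha> \<le> 1" "0 \<le> \<rho>"
    and eq: "\<alpha> * cost E d = (\<Sum>i\<in>voters E. min (bd i) (\<alpha> * utility E i d * \<rho>))"
    using aff by (auto simp: affordable_def)
  have u0: "0 \<le> utility E i d" for i using pos by (simp add: utility_def)
  have U0: "0 \<le> U" by (simp add: U_def u0 sum_nonneg)
  have au: "\<alpha> * utility E i d * \<rho> \<le> utility E i d * \<rho>" for i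
    using a u0[of i] by (intro mult_right_mono mult_left_le_one_le) auto
  have \<rho>: "\<rho> \<le> \<alpha> / ?s" using r a s by (simp add: field_simps)
  have mc: "cost E d \<le> max_cost E"
    using E d by (auto simp: max_cost_def election_def)
  \<comment> \<open>By \<open>rich\<close> nobody in \<open>S\<close> is exhausted, so all
    overspending is charged to voters outside \<open>S\<close>.\<close>
  have KS: "K \<inter> S = {}"
    using rich by (force simp: K_def utility_def supporters_def mult.commute)
  have "\<alpha> * cost E d = (\<Sum>i\<in>S. min (bd i) (\<alpha> * utility E i d * \<rho>))
      + (\<Sum>i\<in>voters E - S. min (bd i) (\<alpha> * utility E i d * \<rho>))"
    unfolding eq using sum.subset_diff[OF S(1) finV] by (simp add: add.commute)
  also have "(\<Sum>i\<in>S. min (bd i) (\<alpha> * utility E i d * \<rho>)) \<le> (\<Sum>i\<in>S. \<alpha> * \<rho> * utility E i d)"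
    by (intro sum_mono) (simp add: mult_ac)
  also have "\<dots> = \<alpha> * \<rho> * U" by (simp add: U_def sum_distrib_left)
  \<comment> \<open>The actual budget drop uses the full charge and hence is at least the payment
    scaled by \<alpha>.\<close>
  also have "(\<Sum>i\<in>voters E - S. min (bd i) (\<alpha> * utility E i d * \<rho>)) \<le> (\<Sum>i\<in>voters E - S. bd i - bd' i)"
  proof (intro sum_mono)
    fix i
    show "min (bd i) (\<alpha> * utility E i d * \<rho>) \<le> bd i - bd' i"
      using au[of i] by (auto simp: bd'_def min_def max_def)
  qed
  finally have pay: "\<alpha> * cost E d \<le> \<alpha> * \<rho> * U + (\<Sum>i\<in>voters E - S. bd i - bd' i)" by simp
  have "\<alpha> * \<rho> * U \<le> U / ?s"
  proof -
    have "\<alpha> / ?s \<le> 1 / ?s" using a s by (intro divide_right_mono) auto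
    with \<rho> have "\<rho> \<le> 1 / ?s" by linarith
    then have "\<alpha> * \<rho> \<le> 1 * (1 / ?s)"
      using a by (intro mult_mono) auto
    then show ?thesis using mult_right_mono[OF _ U0] by fastforce
  qed
  moreover have "cost E d * (1 - \<alpha>) \<le> max_cost E * (real (card K) / (2 * ?s))"
    using one_minus_le_exhausted[OF E nn d aff opt s r] mc pos a
    by (intro mult_mono) (auto simp: K_def)
  moreover have "real (card K) \<le> real (card {i\<in>voters E - S. bd' i = 0}) - real (card {i\<in>voters E - S. bd i = 0})"
  proof -
    have "K \<union> {i\<in>voters E - S. bd i = 0} \<subseteq> {i\<in>voters E - S. bd' i = 0}"
      using KS mult_nonneg_nonneg[OF a(3) less_imp_le[OF pos]]
      by (auto simp: K_def supporters_def bd'_def utility_def mult.commute)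
    moreover have "K \<inter> {i\<in>voters E - S. bd i = 0} = {}" by (auto simp: K_def)
    moreover have "finite K" using finite_supporters[OF E] by (simp add: K_def)
    ultimately have "card K + card {i\<in>voters E - S. bd i = 0} \<le> card {i\<in>voters E - S. bd' i = 0}"
      using finV card_mono[of "{i\<in>voters E - S. bd' i = 0}" "K \<union> {i\<in>voters E - S. bd i = 0}"]
      by (simp add: card_Un_disjoint)
    then show ?thesis by linarith
  qed
  then have "max_cost E / (2 * ?s) * real (card K) \<le> max_cost E / (2 * ?s) *
        (real (card {i\<in>voters E - S. bd' i = 0}) - real (card {i\<in>voters E - S. bd i = 0}))"
    using mc pos s by (intro mult_left_mono) auto
  ultimately show ?thesis using pay by (simp add: U_def algebra_simps)
qed

section \<open>The invariant of a run\<close>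

definition overspending_bound :: "('c, 'v) pb_instance \<Rightarrow> 'v set \<Rightarrow> real" where
  "overspending_bound E S = (num_voters E - real (card S)) / (2 * real (card S)) * max_cost E"

definition satisfied_up_to :: "('c, 'v) pb_instance \<Rightarrow> 'v set \<Rightarrow> 'c set \<Rightarrow> 'c \<Rightarrow> 'c set \<Rightarrow> bool" where
  "satisfied_up_to E S T c W \<longleftrightarrow>
     (\<exists>i\<in>S. set_utility E i W \<ge> total_cost E T - overspending_bound E S - cost E c)"

text \<open>The state of a run before anyone in \<open>S\<close> is satisfied. The last inequality
  values the utility of \<open>S\<close> at \<open>1 / card S\<close> per unit; the remaining cost
  of \<open>W\<close> is met by spending outside \<open>S\<close> plus overspending, with the number
  of empty budgets outside \<open>S\<close> as potential.\<close>

definition group_solvent :: "('c, 'v) pb_instance \<Rightarrow> 'v set \<Rightarrow> 'c \<Rightarrow> 'c set \<Rightarrow> ('v \<Rightarrow> real) \<Rightarrow> bool" where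
  "group_solvent E S c W bd \<longleftrightarrow>
     (\<forall>i\<in>S. cost E c / real (card S) \<le> bd i \<and>
             budget E / num_voters E - bd i \<le> set_utility E i W / real (card S)) \<and>
     total_cost E W - (\<Sum>i\<in>S. set_utility E i W) / real (card S)
       \<le> (\<Sum>i\<in>voters E - S. budget E / num_voters E - bd i)
          + max_cost E / (2 * real (card S)) * real (card {i\<in>voters E - S. bd i = 0})"

context
  fixes E :: "('c, 'v) pb_instance" and S T c
  assumes E: "election E" and S: "S \<subseteq> voters E" "S \<noteq> {}" and T: "T \<subseteq> cands E"
    and des: "deserves E S T" and c: "c \<in> T"
begin

lemma finV: "finite (voters E)"
  using E by (simp add: election_def)

lemma card_S_pos: "0 < real (card S)"
  using S finV by (metis card_gt_0_iff finite_subset of_nat_0_less_iff)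

lemma card_S_le: "real (card S) \<le> num_voters E"
  using S finV by (simp add: num_voters_def card_mono)

lemma c_cand: "c \<in> cands E"
  using c T by auto

lemma cost_pos: "d \<in> cands E \<Longrightarrow> 0 < cost E d"
  using E by (simp add: election_def)

lemma max_cost_nonneg: "0 \<le> max_cost E"
proof -
  have "cost E c \<le> max_cost E" using E c_cand by (auto simp: max_cost_def election_def)
  then show ?thesis using cost_pos[OF c_cand] by simp
qed

lemma overspending_bound_nonneg: "0 \<le> overspending_bound E S"
  using max_cost_nonneg card_S_le by (simp add: overspending_bound_def)

lemma S_supporters: "S \<subseteq> supporters E c"
  using S des c by (auto simp: deserves_def supporters_def)

lemma total_cost_T_le: "total_cost E T \<le> real (card S) * (budget E / num_voters E)"
proof -
  have "0 < num_voters E" "0 < budget E"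
    using E card_S_pos card_S_le by (auto simp: election_def)
  then show ?thesis using des by (simp add: deserves_def field_simps)
qed

text \<open>By averaging: if nobody in \<open>S\<close> is satisfied, the mean utility in
  \<open>S\<close> is at most the target. Outside voters own
  \<open>budget E - card S * (budget E / num_voters E)\<close> in total, and at most all of them are
  empty, so the invariant leaves room for \<open>c\<close>.\<close>

lemma satisfied_if_not_fitting:
  assumes "group_solvent E S c W bd" and nn: "\<And>i. 0 \<le> bd i"
    and nofit: "budget E - total_cost E W < cost E c"
  shows "satisfied_up_to E S T c W"
proof (rule ccontr)
  let ?s = "real (card S)" and ?B = "budget E / num_voters E"
  assume "\<not> ?thesis"
  then have "(\<Sum>i\<in>S. set_utility E i W) \<le> (\<Sum>i\<in>S. total_cost E T - overspending_bound E S - cost E c)"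
    by (intro sum_mono) (auto simp: satisfied_up_to_def)
  then have avg: "(\<Sum>i\<in>S. set_utility E i W) / ?s \<le> total_cost E T - overspending_bound E S - cost E c"
    using card_S_pos by (simp add: field_simps)
  have card_diff: "real (card (voters E - S)) = num_voters E - ?s"
    using S finV by (simp add: num_voters_def card_Diff_subset finite_subset card_mono of_nat_diff)
  have "(\<Sum>i\<in>voters E - S. ?B - bd i) \<le> (\<Sum>i\<in>voters E - S. ?B)"
    using nn by (intro sum_mono) simp
  also have "\<dots> = budget E - ?s * ?B"
    using card_diff card_S_pos card_S_le by (simp add: left_diff_distrib diff_divide_distrib)
  finally have out: "(\<Sum>i\<in>voters E - S. ?B - bd i) \<le> budget E - ?s * ?B" .
  have "max_cost E / (2 * ?s) * real (card {i\<in>voters E - S. bd i = 0})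
      \<le> max_cost E / (2 * ?s) * real (card (voters E - S))"
    using max_cost_nonneg finV by (intro mult_left_mono of_nat_mono card_mono) auto
  also have "\<dots> = overspending_bound E S"
    by (simp add: card_diff overspending_bound_def)
  finally show False
    using assms(1) avg out nofit total_cost_T_le by (auto simp: group_solvent_def)
qed

text \<open>Satisfaction persists because utilities only grow. Otherwise \<open>c\<close> itself
  competes at ratio at most \<open>1 / card S\<close>, which bounds the ratio of the chosen
  purchase.\<close>

lemma bos_state_invariant:
  assumes "bos_state E W bd" and "c \<notin> W"
  shows "satisfied_up_to E S T c W \<or> group_solvent E S c W bd"
  using assms
proof (induction)
  case init
  have "finite T" using T E finite_subset by (auto simp: election_def)
  then have "cost E c \<le> total_cost E T"
    unfolding total_cost_def using c T cost_pos by (intro member_le_sum) (auto intro: less_imp_le)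
  then have "cost E c / real (card S) \<le> budget E / num_voters E"
    using total_cost_T_le card_S_pos by (simp add: field_simps)
  then show ?case
    using max_cost_nonneg by (simp add: group_solvent_def total_cost_def set_utility_def)
next
  case (step W bd d \<alpha> \<rho>)
  let ?s = "real (card S)" and ?B = "budget E / num_voters E"
  let ?bd = "\<lambda>i. max 0 (bd i - utility E i d * \<rho>)"
  from step.prems have cW: "c \<notin> W" by simp
  have "finite W" and nn: "\<And>i. 0 \<le> bd i" using bos_state_basic[OF E step.hyps(1)] by auto
  have d: "d \<in> cands E" "d \<notin> W" and aff: "affordable E bd d \<alpha> \<rho>"
    and fit_d: "cost E d \<le> budget E - total_cost E W"
    using step.hyps(2) by (auto simp: bos_choices_def)
  have u0: "0 \<le> utility E i d" for i using cost_pos[OF d(1)] by (simp add: utility_def)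
  have u_insert: "set_utility E i (insert d W) = utility E i d + set_utility E i W" for i
    using \<open>finite W\<close> d by (simp add: set_utility_def)
  show ?case
  proof (cases "satisfied_up_to E S T c W")
    case True
    then obtain i where "i \<in> S" "total_cost E T - overspending_bound E S - cost E c \<le> set_utility E i W"
      by (auto simp: satisfied_up_to_def)
    then have "satisfied_up_to E S T c (insert d W)"
      using u0[of i] by (auto simp: satisfied_up_to_def u_insert intro!: bexI[of _ i])
    then show ?thesis ..
  next
    case unsat: False
    then have solv: "group_solvent E S c W bd" using step.IH cW by blast
    then have fit: "cost E c \<le> budget E - total_cost E W"
      using satisfied_if_not_fitting nn unsat by force
    have "\<And>i. i \<in> S \<Longrightarrow> cost E c / ?s \<le> bd i" using solv by (simp add: group_solvent_def)
    then obtain \<rho>' where "affordable E bd c 1 \<rho>'" "\<rho>' \<le> 1 / ?s"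
      using affordable_of_rich_group[where bd = bd, OF E nn c_cand S_supporters S(2)] by blast
    moreover from this have "(c, 1, \<rho>') \<in> bos_choices E W bd"
      using fit cW c_cand by (simp add: bos_choices_def)
    ultimately have r: "\<rho> / \<alpha> \<le> 1 / ?s" using step.hyps(3) by fastforce
    have a: "0 < \<alpha>" "\<alpha> \<le> 1" "0 \<le> \<rho>" using aff by (auto simp: affordable_def)
    have "\<rho> \<le> \<rho> / \<alpha>" using a by (simp add: field_simps mult_left_le_one_le)
    with r have r1: "\<rho> \<le> 1 / ?s" by simp
    have spent: "?B - ?bd i \<le> set_utility E i (insert d W) / ?s" if "i \<in> S" for i
    proof -
      have "?B - bd i \<le> set_utility E i W / ?s" using solv that by (simp add: group_solvent_def)
      moreover have "utility E i d * \<rho> \<le> utility E i d * (1 / ?s)"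
        using r1 u0 by (intro mult_left_mono) auto
      ultimately show ?thesis by (simp add: u_insert add_divide_distrib)
    qed
    show ?thesis
    proof (cases "\<forall>i\<in>S. cost E c / ?s \<le> ?bd i")
      case False
      then obtain i where i: "i \<in> S" "?bd i < cost E c / ?s" by (auto simp: not_le)
      \<comment> \<open>Voter \<open>i\<close> has spent nearly its whole endowment at no more than
        \<open>1 / ?s\<close> per unit of utility, so its utility exceeds
        \<open>?s * ?B - cost E c\<close>.\<close>
      have "?B - cost E c / ?s < set_utility E i (insert d W) / ?s"
        using spent[OF i(1)] i(2) by linarith
      then have "?s * (?B - cost E c / ?s) < ?s * (set_utility E i (insert d W) / ?s)"
        using card_S_pos by (intro mult_strict_left_mono)
      then have "?s * ?B - cost E c < set_utility E i (insert d W)"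
        using card_S_pos by (simp add: right_diff_distrib)
      then have "satisfied_up_to E S T c (insert d W)"
        using i(1) total_cost_T_le overspending_bound_nonneg
        by (auto simp: satisfied_up_to_def intro!: bexI[of _ i])
      then show ?thesis ..
    next
      case True
      \<comment> \<open>The positive lower bound on the new budget shows that the truncation at 0 is
        inactive on \<open>S\<close>.\<close>
      have "utility E i d * \<rho> < bd i" if "i \<in> S" for i
      proof -
        have "0 < cost E c / ?s" using cost_pos[OF c_cand] card_S_pos by simp
        then have "0 < ?bd i" using True that by fastforce
        then show ?thesis by simp
      qed
      moreover have "\<rho> / \<alpha> \<le> \<rho>'' / \<alpha>''" if "affordable E bd d \<alpha>'' \<rho>''" for \<alpha>'' \<rho>''
        using step.hyps(3) that d fit_d by (force simp: bos_choices_def)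
      ultimately have
        "cost E d - (\<Sum>i\<in>S. utility E i d) / ?s
          \<le> (\<Sum>i\<in>voters E - S. bd i - ?bd i) + max_cost E / (2 * ?s) *
           (real (card {i\<in>voters E - S. ?bd i = 0}) - real (card {i\<in>voters E - S. bd i = 0}))"
        by (intro purchase_outside_payment[OF E nn S d(1) aff _ r]) auto
      moreover have "total_cost E W - (\<Sum>i\<in>S. set_utility E i W) / ?s
          \<le> (\<Sum>i\<in>voters E - S. ?B - bd i)
            + max_cost E / (2 * ?s) * real (card {i\<in>voters E - S. bd i = 0})"
        using solv by (simp add: group_solvent_def)
      moreover have "(\<Sum>i\<in>voters E - S. ?B - ?bd i)
          = (\<Sum>i\<in>voters E - S. ?B - bd i) + (\<Sum>i\<in>voters E - S. bd i - ?bd i)"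
        by (simp add: sum.distrib[symmetric])
      moreover have "total_cost E (insert d W) = cost E d + total_cost E W"
        using \<open>finite W\<close> d by (simp add: total_cost_def)
      moreover have "(\<Sum>i\<in>S. set_utility E i (insert d W)) / ?s
          = (\<Sum>i\<in>S. utility E i d) / ?s + (\<Sum>i\<in>S. set_utility E i W) / ?s"
        by (simp add: u_insert sum.distrib add_divide_distrib)
      ultimately have "total_cost E (insert d W) - (\<Sum>i\<in>S. set_utility E i (insert d W)) / ?s
          \<le> (\<Sum>i\<in>voters E - S. ?B - ?bd i)
            + max_cost E / (2 * ?s) * real (card {i\<in>voters E - S. ?bd i = 0})"
        unfolding right_diff_distrib by linarith
      then show ?thesis
        using True spent by (simp add: group_solvent_def)
    qed
  qed
qed

text \<open>An unsatisfied group would be solvent at termination, so \<open>c\<close> would fit and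
  be affordable with fraction 1, contradicting the empty set of choices.\<close>

lemma satisfied_by_outcome:
  assumes "bos_outcome E W" and cW: "c \<notin> W"
  shows "satisfied_up_to E S T c W"
proof (rule ccontr)
  assume unsat: "\<not> ?thesis"
  obtain bd where st: "bos_state E W bd" and stop: "bos_choices E W bd = {}"
    using assms by (auto simp: bos_outcome_def)
  have nn: "\<And>i. 0 \<le> bd i" using bos_state_basic[OF E st] by auto
  have solv: "group_solvent E S c W bd" using bos_state_invariant[OF st cW] unsat by blast
  then have "cost E c \<le> budget E - total_cost E W"
    using satisfied_if_not_fitting nn unsat by force
  moreover have "\<And>i. i \<in> S \<Longrightarrow> cost E c / real (card S) \<le> bd i"
    using solv by (simp add: group_solvent_def)
  then obtain \<rho> where "affordable E bd c 1 \<rho>"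
    using affordable_of_rich_group[where bd = bd, OF E nn c_cand S_supporters S(2)] by blast
  ultimately have "(c, 1, \<rho>) \<in> bos_choices E W bd"
    using cW c_cand by (simp add: bos_choices_def)
  then show False using stop by simp
qed

end

section \<open>One voter for all missing candidates\<close>

theorem theorem3:
  fixes E :: "('c, 'v) pb_instance" and W T :: "'c set" and S :: "'v set"
  assumes "election E"
    and "bos_outcome E W"
    and "S \<subseteq> voters E" and "S \<noteq> {}"
    and "T \<subseteq> cands E"
    and "deserves E S T"
  shows "\<exists>i\<in>S. \<forall>c \<in> T - W.
           set_utility E i W \<ge>
             total_cost E T
             - (num_voters E - real (card S)) / (2 * real (card S)) * max_cost E
             - cost E c"
proof (cases "T - W = {}")
  case True
  then show ?thesis using \<open>S \<noteq> {}\<close> by auto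
next
  case False
  have "finite (T - W)" using assms by (auto simp: election_def intro: finite_subset)
  \<comment> \<open>The voter must be chosen before the candidate; the cheapest missing candidate
    gives the strongest requirement, so its voter serves all others.\<close>
  then obtain c where c: "c \<in> T - W" and min: "\<And>d. d \<in> T - W \<Longrightarrow> cost E c \<le> cost E d"
    using False by (metis arg_min_if_finite(1) arg_min_least)
  have "satisfied_up_to E S T c W"
    using satisfied_by_outcome[OF assms(1,3-6)] assms(2) c by blast
  then obtain i where "i \<in> S"
    "total_cost E T - overspending_bound E S - cost E c \<le> set_utility E i W"
    by (auto simp: satisfied_up_to_def)
  then show ?thesis
    using min by (intro bexI[of _ i]) (force simp: overspending_bound_def)+
qed

end
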